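(* Let $A\in\mathbb{R}^{m\times n}$ and $B\in\mathbb{R}^{l\times n}$ be given matrices with $m<n$ and $l\le n$, let $y\in\mathbb{R}^m$ and $b\in\mathbb{R}^l$ be given vectors, let $\epsilon\ge 0$, and let $T=\{x\in\mathbb{R}^n:\ \|y-Ax\|_2\le\epsilon,\ Bx\le b\}$. Let $w\in\mathbb{R}^n$ be a given weight such that (G1) the problem $(P_w)$: $\min_x\{w^T|x|:\ x\in T\}$ has an optimal solution $\hat x$ which lies in the relative interior $\mathrm{ri}(T)$ of $T$ and satisfies $\|y-A\hat x\|_2<\epsilon$, $B\hat x\le b$; (G2) the optimal value $Z^*$ of $(P_w)$ is finite and positive, i.e. $Z^*\in(0,\infty)$; (G3) $w_j\in(0,\infty)$ for all $1\le j\le n$. Then there exists a pair $((x^*,t^*,\gamma^* ),\lambda^* )$, where $(x^*,t^*,\gamma^* )$ is an optimal solution of the problem $(P'_w)$ and $\lambda^*=(\lambda_1^*,\dots,\lambda_6^* )$ is an optimal solution of its dual $(D_w)$, such that $t^*$ and $\lambda_6^*$ are strictly complementary, i.e. $$(t^* )^T\lambda_6^*=0,\qquad t^*+\lambda_6^*>0,\qquad (t^*,\lambda_6^* )\ge 0.$$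
   Context: $|x|$ is the componentwise absolute value; vector inequalities are componentwise. $(P'_w)$ is the reformulation of $(P_w)$ $$\min_{(x,\gamma,t)}\ w^Tt\quad\text{s.t.}\quad \|\gamma\|_2\le\epsilon,\ Bx\le b,\ \gamma=y-Ax,\ |x|\le t,\ t\ge 0,$$ with $x,t\in\mathbb{R}^n$, $\gamma\in\mathbb{R}^m$. The dual problem $(D_w)$ of $(P'_w)$, in the variables $\lambda=(\lambda_1,\dots,\lambda_6)$ with $\lambda_1\in\mathbb{R}$, $\lambda_2\in\mathbb{R}^l$, $\lambda_3\in\mathbb{R}^m$, $\lambda_4,\lambda_5,\lambda_6\in\mathbb{R}^n$, is $$\max_\lambda\ -\lambda_1\epsilon-\lambda_2^Tb+\lambda_3^Ty\quad\text{s.t.}\quad B^T\lambda_2-A^T\lambda_3+\lambda_4-\lambda_5=0,\ w=\lambda_4+\lambda_5+\lambda_6,\ \|\lambda_3\|_2\le\lambda_1,\ \lambda_i\ge0\ (i=1,2,4,5,6).$$ *)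

theory Defs
  imports "HOL-Analysis.Analysis"
begin

text \<open>
  On \<^typ>\<open>real^'n\<close> the library's \<open>\<bar>x\<bar>\<close> and \<open>x \<le> y\<close> are componentwise and \<^const>\<open>norm\<close> is the Euclidean
  norm. The library's \<open>x < y\<close>, however, only means \<open>x \<le> y \<and> \<not> y \<le> x\<close>, so strict vector inequalities
  are written out by components.
\<close>

definition feasible_T ::
  "real^'n^'m \<Rightarrow> real^'n^'l \<Rightarrow> real^'m \<Rightarrow> real^'l \<Rightarrow> real \<Rightarrow> (real^'n) set" where
  "feasible_T A B y b \<epsilon> = {x. norm (y - A *v x) \<le> \<epsilon> \<and> B *v x \<le> b}"

definition optimal_Pw ::
  "real^'n^'m \<Rightarrow> real^'n^'l \<Rightarrow> real^'m \<Rightarrow> real^'l \<Rightarrow> real \<Rightarrow> real^'n \<Rightarrow> real^'n \<Rightarrow> bool" where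
  "optimal_Pw A B y b \<epsilon> w x \<longleftrightarrow>
     is_arg_min (\<lambda>x. w \<bullet> \<bar>x\<bar>) (\<lambda>x. x \<in> feasible_T A B y b \<epsilon>) x"

text \<open>Extended reals, so that infeasible and unbounded problems have values \<open>\<infinity>\<close> and \<open>-\<infinity>\<close>.\<close>

definition value_Pw ::
  "real^'n^'m \<Rightarrow> real^'n^'l \<Rightarrow> real^'m \<Rightarrow> real^'l \<Rightarrow> real \<Rightarrow> real^'n \<Rightarrow> ereal" where
  "value_Pw A B y b \<epsilon> w = (INF x\<in>feasible_T A B y b \<epsilon>. ereal (w \<bullet> \<bar>x\<bar>))"

definition feasible_Pw' ::
  "real^'n^'m \<Rightarrow> real^'n^'l \<Rightarrow> real^'m \<Rightarrow> real^'l \<Rightarrow> real \<Rightarrow>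
   ((real^'n) \<times> (real^'n) \<times> (real^'m)) set" where
  "feasible_Pw' A B y b \<epsilon> =
     {(x, t, \<gamma>). norm \<gamma> \<le> \<epsilon> \<and> B *v x \<le> b \<and> \<gamma> = y - A *v x \<and> \<bar>x\<bar> \<le> t \<and> 0 \<le> t}"

definition optimal_Pw' ::
  "real^'n^'m \<Rightarrow> real^'n^'l \<Rightarrow> real^'m \<Rightarrow> real^'l \<Rightarrow> real \<Rightarrow> real^'n \<Rightarrow>
   (real^'n) \<times> (real^'n) \<times> (real^'m) \<Rightarrow> bool" where
  "optimal_Pw' A B y b \<epsilon> w p \<longleftrightarrow>
     is_arg_min (\<lambda>(x, t, \<gamma>). w \<bullet> t) (\<lambda>p. p \<in> feasible_Pw' A B y b \<epsilon>) p"

text \<open>The dual variables \<open>(\<lambda>\<^sub>1, \<dots>, \<lambda>\<^sub>6)\<close> are written \<open>\<mu>1, \<dots>, \<mu>6\<close>.\<close>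

type_synonym ('l, 'm, 'n) dual_var =
  "real \<times> (real^'l) \<times> (real^'m) \<times> (real^'n) \<times> (real^'n) \<times> (real^'n)"

definition feasible_Dw ::
  "real^'n^'m \<Rightarrow> real^'n^'l \<Rightarrow> real^'n \<Rightarrow> ('l, 'm, 'n) dual_var set" where
  "feasible_Dw A B w =
     {(\<mu>1, \<mu>2, \<mu>3, \<mu>4, \<mu>5, \<mu>6).
        transpose B *v \<mu>2 - transpose A *v \<mu>3 + \<mu>4 - \<mu>5 = 0 \<and>
        w = \<mu>4 + \<mu>5 + \<mu>6 \<and>
        norm \<mu>3 \<le> \<mu>1 \<and>
        0 \<le> \<mu>1 \<and> 0 \<le> \<mu>2 \<and> 0 \<le> \<mu>4 \<and> 0 \<le> \<mu>5 \<and> 0 \<le> \<mu>6}"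

definition objective_Dw ::
  "real^'m \<Rightarrow> real^'l \<Rightarrow> real \<Rightarrow> ('l, 'm, 'n) dual_var \<Rightarrow> real" where
  "objective_Dw y b \<epsilon> = (\<lambda>(\<mu>1, \<mu>2, \<mu>3, \<mu>4, \<mu>5, \<mu>6). - \<mu>1 * \<epsilon> - \<mu>2 \<bullet> b + \<mu>3 \<bullet> y)"

definition optimal_Dw ::
  "real^'n^'m \<Rightarrow> real^'n^'l \<Rightarrow> real^'m \<Rightarrow> real^'l \<Rightarrow> real \<Rightarrow> real^'n \<Rightarrow>
   ('l, 'm, 'n) dual_var \<Rightarrow> bool" where
  "optimal_Dw A B y b \<epsilon> w p \<longleftrightarrow>
     is_arg_max (objective_Dw y b \<epsilon>) (\<lambda>p. p \<in> feasible_Dw A B w) p"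

definition strictly_complementary :: "real^'n \<Rightarrow> real^'n \<Rightarrow> bool" where
  "strictly_complementary u v \<longleftrightarrow>
     u \<bullet> v = 0 \<and> (\<forall>i. 0 < (u + v) $ i) \<and> 0 \<le> u \<and> 0 \<le> v"

end

theory Submission
  imports Defs
begin

text \<open>
  Because the norm constraint is slack at the optimal point \<open>x0\<close> supplied by (G1), it can be dropped: any
  point satisfying the linear constraints can be moved towards \<open>x0\<close> until it satisfies the norm
  constraint too. Strict complementarity is thus that of a linear program, with \<open>\<mu>1 = 0\<close> and \<open>\<mu>3 = 0\<close>.
  Take an optimal \<open>t\<close> of maximal support and let \<open>p\<close> be the indicator of its zeros. Farkas' lemma
  provides a dual optimal point with \<open>\<mu>6 > 0\<close> on the support of \<open>p\<close>, because the alternative would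
  yield either an optimal \<open>t\<close> with larger support or a value below the optimum.
\<close>

section \<open>Farkas' lemma for linear images of the nonnegative cone\<close>

lemma convex_cone_nonneg: "convex_cone {u::'a::ordered_euclidean_space. 0 \<le> u}"
  unfolding convex_cone_iff using scaleR_nonneg_nonneg by (blast intro: add_nonneg_nonneg)

text \<open>The nonnegative cone is generated by the finitely many basis vectors, so its image is a
  finitely generated cone, and such cones are closed. Closedness is what permits strict separation
  in \<open>farkas\<close>.\<close>

lemma closed_linear_image_nonneg:
  fixes L :: "'a::ordered_euclidean_space \<Rightarrow> 'b::euclidean_space"
  assumes "linear L"
  shows "closed (L ` {u. 0 \<le> u})"
proof -
  have "{u::'a. 0 \<le> u} = convex_cone hull Basis"
  proof
    show "convex_cone hull Basis \<subseteq> {u::'a. 0 \<le> u}"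
      by (intro hull_minimal convex_cone_nonneg subsetI CollectI) (simp add: eucl_le[where 'a='a] inner_Basis)
    show "{u::'a. 0 \<le> u} \<subseteq> convex_cone hull Basis"
    proof clarify
      fix u :: 'a assume u: "0 \<le> u"
      have "(\<Sum>i\<in>C. (u \<bullet> i) *\<^sub>R i) \<in> convex_cone hull Basis" if "C \<subseteq> Basis" for C
        using finite_subset[OF that finite_Basis] that
      proof (induction C rule: finite_induct)
        case empty
        then show ?case by (simp add: convex_cone_hull_contains_0)
      next
        case (insert i C)
        moreover have "0 \<le> u \<bullet> i"
          using u insert.prems by (auto simp: eucl_le[where 'a='a])
        ultimately show ?case
          by (simp add: convex_cone_hull_add convex_cone_hull_mul hull_inc)
      qed
      from this[of Basis] show "u \<in> convex_cone hull Basis"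
        by (simp add: euclidean_representation)
    qed
  qed
  then have "L ` {u. 0 \<le> u} = convex_cone hull (L ` Basis)"
    by (simp add: convex_cone_hull_linear_image[OF assms])
  then show ?thesis
    by (simp add: closed_convex_cone_hull)
qed

lemma farkas:
  fixes L :: "'a::ordered_euclidean_space \<Rightarrow> 'b::euclidean_space"
  assumes L: "linear L"
    and z: "\<And>h. (\<And>u. 0 \<le> u \<Longrightarrow> 0 \<le> h \<bullet> L u) \<Longrightarrow> 0 \<le> h \<bullet> z"
  obtains u where "0 \<le> u" "L u = z"
proof (rule ccontr)
  assume "\<not> thesis"
  with that have "z \<notin> L ` {u. 0 \<le> u}" by auto
  moreover have "convex (L ` {u. 0 \<le> u})"
    using convex_cone_nonneg by (intro convex_linear_image L) (auto simp: convex_cone_def)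
  ultimately obtain a c where ac: "a \<bullet> z < c" "\<And>u. 0 \<le> u \<Longrightarrow> c < a \<bullet> L u"
    using separating_hyperplane_closed_point[OF _ closed_linear_image_nonneg[OF L]] by blast
  from ac(2)[of 0] have "c < 0" by (simp add: linear_0[OF L])
  have "0 \<le> a \<bullet> L u" if u: "0 \<le> u" for u
  proof (rule ccontr)
    assume neg: "\<not> 0 \<le> a \<bullet> L u"
    \<comment> \<open>Scaling \<open>u\<close> by \<open>r\<close> moves
      \<open>a \<bullet> L u\<close> exactly onto the level \<open>c\<close>, which every point of
      the cone must exceed strictly.\<close>
    define r where "r = c / (a \<bullet> L u)"
    have "0 \<le> r" using neg \<open>c < 0\<close> by (simp add: r_def divide_nonpos_neg)
    then have "c < a \<bullet> L (r *\<^sub>R u)"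
      using u by (intro ac(2)) (rule scaleR_nonneg_nonneg)
    then show False using neg by (simp add: linear_scale[OF L] r_def)
  qed
  from z[OF this] ac(1) \<open>c < 0\<close> show False by simp
qed

section \<open>Dual multipliers from the Farkas alternative\<close>

lemma nonneg_if_inner_nonneg:
  fixes z :: "'a::ordered_euclidean_space"
  assumes "\<And>v. 0 \<le> v \<Longrightarrow> 0 \<le> v \<bullet> z"
  shows "0 \<le> z"
  using assms by (auto simp: eucl_le[where 'a='a] inner_Basis inner_commute)

lemma inner_transpose:
  fixes B :: "real^'n^'l"
  shows "(transpose B *v v) \<bullet> x = v \<bullet> (B *v x)"
  by (simp add: dot_lmul_matrix)

text \<open>
  The premise is homogenised (\<open>s\<close> scales the right-hand side, \<open>s = 0\<close> being the recession case), and the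
  multiplier \<open>\<theta>\<close> belongs to its constraint \<open>w \<bullet> t \<le> s * Z\<close>. Dividing the conclusion by \<open>1 + \<theta>\<close> gives a
  point of the dual with value at least \<open>Z\<close> and last component \<open>(\<mu>6 + p) / (1 + \<theta>)\<close>.
\<close>

lemma dual_from_alternative:
  fixes B :: "real^'n^'l" and b :: "real^'l" and w p :: "real^'n" and Z :: real
  assumes alt: "\<And>s x t. 0 \<le> s \<Longrightarrow> B *v x \<le> s *\<^sub>R b \<Longrightarrow> \<bar>x\<bar> \<le> t \<Longrightarrow> w \<bullet> t \<le> s * Z
                  \<Longrightarrow> s * Z \<le> w \<bullet> t - p \<bullet> t"
  obtains \<theta> \<mu>2 \<mu>4 \<mu>5 \<mu>6 where "0 \<le> \<theta>" "0 \<le> \<mu>2" "0 \<le> \<mu>4" "0 \<le> \<mu>5" "0 \<le> \<mu>6"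
    "transpose B *v \<mu>2 + \<mu>4 - \<mu>5 = 0" "(1 + \<theta>) *\<^sub>R w = \<mu>4 + \<mu>5 + \<mu>6 + p" "(1 + \<theta>) * Z \<le> - (\<mu>2 \<bullet> b)"
proof -
  \<comment> \<open>The equation \<open>L u = (0, w - p, Z)\<close> encodes the three relations to
    be obtained; \<open>\<sigma>\<close> is the slack that turns the bound on the value into an
    equation.\<close>
  define L :: "(real^'l) \<times> (real^'n) \<times> (real^'n) \<times> (real^'n) \<times> real \<times> real \<Rightarrow> (real^'n) \<times> (real^'n) \<times> real"
    where "L = (\<lambda>(\<mu>2, \<mu>4, \<mu>5, \<mu>6, \<sigma>, \<theta>). (transpose B *v \<mu>2 + \<mu>4 - \<mu>5, \<mu>4 + \<mu>5 + \<mu>6 - \<theta> *\<^sub>R w,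
             - (\<mu>2 \<bullet> b) - \<sigma> - \<theta> * Z))"
  have "linear L"
  proof (rule linearI)
    show "L (u + v) = L u + L v" for u v
      by (cases u rule: prod_cases6; cases v rule: prod_cases6)
        (simp add: L_def matrix_vector_right_distrib inner_add_left scaleR_add_left distrib_right
          del: transpose_matrix_vector)
    show "L (r *\<^sub>R u) = r *\<^sub>R L u" for r u
      by (cases u rule: prod_cases6)
        (simp add: L_def matrix_vector_mult_scaleR scaleR_add_right scaleR_diff_right right_diff_distrib
          del: transpose_matrix_vector)
  qed
  moreover have "0 \<le> h \<bullet> (0, w - p, Z)" if h: "\<And>u. 0 \<le> u \<Longrightarrow> 0 \<le> h \<bullet> L u" for h
  proof -
    \<comment> \<open>Up to sign, the functional \<open>h\<close> is a homogenised primal point: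
      \<open>- x\<close> and \<open>t\<close> with scale \<open>- \<tau>\<close>. Setting all
      multipliers but one to zero in \<open>*\<close> extracts its constraints one at a
      time.\<close>
    obtain x t \<tau> where h_eq: "h = (x, t, \<tau>)" by (rule prod_cases3)
    have *: "0 \<le> x \<bullet> (transpose B *v \<mu>2 + \<mu>4 - \<mu>5) + (t \<bullet> (\<mu>4 + \<mu>5 + \<mu>6 - \<theta> *\<^sub>R w)
               + \<tau> * (- (\<mu>2 \<bullet> b) - \<sigma> - \<theta> * Z))"
      if "0 \<le> \<mu>2" "0 \<le> \<mu>4" "0 \<le> \<mu>5" "0 \<le> \<mu>6" "0 \<le> \<sigma>" "0 \<le> \<theta>" for \<mu>2 \<mu>4 \<mu>5 \<mu>6 \<sigma> \<theta>
      using h[of "(\<mu>2, \<mu>4, \<mu>5, \<mu>6, \<sigma>, \<theta>)"] that by (simp add: L_def h_eq less_eq_prod_def)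
    have "0 \<le> B *v x - \<tau> *\<^sub>R b"
    proof (rule nonneg_if_inner_nonneg)
      fix v :: "real^'l" assume "0 \<le> v"
      from *[OF this, of 0 0 0 0 0] show "0 \<le> v \<bullet> (B *v x - \<tau> *\<^sub>R b)"
        by (simp add: inner_diff_right inner_commute[of x] inner_transpose del: transpose_matrix_vector)
    qed
    moreover have "0 \<le> x + t"
    proof (rule nonneg_if_inner_nonneg)
      fix v :: "real^'n" assume "0 \<le> v"
      from *[OF _ this, of 0 0 0 0 0] show "0 \<le> v \<bullet> (x + t)"
        by (simp add: inner_add_right inner_commute)
    qed
    moreover have "0 \<le> t - x"
    proof (rule nonneg_if_inner_nonneg)
      fix v :: "real^'n" assume "0 \<le> v"
      from *[OF _ _ this, of 0 0 0 0 0] show "0 \<le> v \<bullet> (t - x)"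
        by (simp add: inner_diff_right inner_commute)
    qed
    moreover have "\<tau> \<le> 0"
      using *[of 0 0 0 0 1 0] by simp
    moreover have "w \<bullet> t \<le> - \<tau> * Z"
      using *[of 0 0 0 0 0 1] by (simp add: inner_commute)
    moreover have "B *v (- x) = - (B *v x)"
      using matrix_vector_mult_diff_distrib[of B 0 x] by simp
    moreover have "\<bar>x\<bar> \<le> t"
      using \<open>0 \<le> x + t\<close> \<open>0 \<le> t - x\<close> diff_ge_0_iff_ge[of t "- x"]
      by (intro abs_leI) (simp_all add: add.commute)
    ultimately have "- \<tau> * Z \<le> w \<bullet> t - p \<bullet> t"
      by (intro alt[of "- \<tau>" "- x" t]) simp_all
    then show ?thesis by (simp add: h_eq inner_diff_right inner_commute)
  qed
  ultimately obtain u where u: "0 \<le> u" "L u = (0, w - p, Z)"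
    by (rule farkas)
  obtain \<mu>2 \<mu>4 \<mu>5 \<mu>6 \<sigma> \<theta> where "u = (\<mu>2, \<mu>4, \<mu>5, \<mu>6, \<sigma>, \<theta>)" by (rule prod_cases6)
  with u have nonneg: "0 \<le> \<mu>2" "0 \<le> \<mu>4" "0 \<le> \<mu>5" "0 \<le> \<mu>6" "0 \<le> \<sigma>" "0 \<le> \<theta>"
    and eqs: "transpose B *v \<mu>2 + \<mu>4 - \<mu>5 = 0" "\<mu>4 + \<mu>5 + \<mu>6 - \<theta> *\<^sub>R w = w - p"
      "- (\<mu>2 \<bullet> b) - \<sigma> - \<theta> * Z = Z"
    by (simp_all add: L_def less_eq_prod_def del: transpose_matrix_vector)
  have "(1 + \<theta>) *\<^sub>R w = (w - p) + \<theta> *\<^sub>R w + p"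
    by (simp add: scaleR_add_left)
  then have "(1 + \<theta>) *\<^sub>R w = \<mu>4 + \<mu>5 + \<mu>6 + p"
    by (simp only: eqs(2)[symmetric] diff_add_cancel)
  moreover have "(1 + \<theta>) * Z \<le> - (\<mu>2 \<bullet> b)"
    using eqs(3) nonneg(5) by (simp add: distrib_right)
  ultimately show ?thesis
    using nonneg eqs(1) by (intro that[of \<theta> \<mu>2 \<mu>4 \<mu>5 \<mu>6])
qed

section \<open>Maximal support, and the geometry of the primal feasible set\<close>

lemma convex_nonneg_maximal_support:
  fixes S :: "(real^'n) set"
  assumes "convex S" "S \<noteq> {}" "\<And>s. s \<in> S \<Longrightarrow> 0 \<le> s"
  obtains z where "z \<in> S" "\<And>j s. s \<in> S \<Longrightarrow> z $ j = 0 \<Longrightarrow> s $ j = 0"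
proof -
  \<comment> \<open>For each \<open>j\<close>, take a point of \<open>S\<close> that is nonzero at
    \<open>j\<close> if there is one, and any point of \<open>S\<close> otherwise. In the average of
    these points nonnegativity excludes cancellation, so it vanishes at \<open>j\<close> only if all
    of \<open>S\<close> does.\<close>
  have "\<exists>f. \<forall>j. f j \<in> S \<and> (\<forall>s\<in>S. f j $ j = 0 \<longrightarrow> s $ j = 0)"
    using \<open>S \<noteq> {}\<close> by (intro choice) blast
  then obtain f where f: "\<And>j. f j \<in> S" "\<And>j s. s \<in> S \<Longrightarrow> f j $ j = 0 \<Longrightarrow> s $ j = 0"
    by blast
  define z where "z = (\<Sum>k\<in>UNIV. (1 / real CARD('n)) *\<^sub>R f k)"
  have "z \<in> S"
    unfolding z_def by (rule convex_sum) (use assms f in auto)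
  moreover have "s $ j = 0" if "s \<in> S" "z $ j = 0" for j s
  proof -
    have "(\<Sum>k\<in>UNIV. f k $ j / real CARD('n)) = 0"
      using that(2) by (simp add: z_def)
    moreover have "0 \<le> f k $ j / real CARD('n)" for k
      using assms(3)[OF f(1)[of k]] by (simp add: less_eq_vec_def)
    ultimately have "f j $ j / real CARD('n) = 0"
      by (subst (asm) sum_nonneg_eq_0_iff) auto
    then show ?thesis using f(2) that(1) by simp
  qed
  ultimately show ?thesis by (rule that)
qed

lemma abs_convex_combination_le:
  fixes x x' t t' :: "real^'n"
  assumes "\<bar>x\<bar> \<le> t" "\<bar>x'\<bar> \<le> t'" "0 \<le> u" "0 \<le> v"
  shows "\<bar>u *\<^sub>R x + v *\<^sub>R x'\<bar> \<le> u *\<^sub>R t + v *\<^sub>R t'"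
proof -
  have "\<bar>u *\<^sub>R x + v *\<^sub>R x'\<bar> \<le> u *\<^sub>R \<bar>x\<bar> + v *\<^sub>R \<bar>x'\<bar>"
    using abs_triangle_ineq[of "u *\<^sub>R x" "v *\<^sub>R x'"] assms(3,4) by (simp add: abs_scaleR)
  also have "\<dots> \<le> u *\<^sub>R t + v *\<^sub>R t'"
    using assms by (intro add_mono scaleR_left_mono)
  finally show ?thesis .
qed

lemma matrix_convex_combination_le:
  fixes B :: "real^'n^'l"
  assumes "B *v x \<le> b" "B *v x' \<le> b" "0 \<le> u" "0 \<le> v" "u + v = 1"
  shows "B *v (u *\<^sub>R x + v *\<^sub>R x') \<le> b"
proof -
  have "B *v (u *\<^sub>R x + v *\<^sub>R x') = u *\<^sub>R (B *v x) + v *\<^sub>R (B *v x')"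
    by (simp add: matrix_vector_right_distrib matrix_vector_mult_scaleR)
  also have "\<dots> \<le> u *\<^sub>R b + v *\<^sub>R b"
    using assms by (intro add_mono scaleR_left_mono)
  also have "\<dots> = b"
    using assms(5) by (simp flip: scaleR_add_left)
  finally show ?thesis .
qed

text \<open>This is the projection of \<open>feasible_Pw'\<close> to the
  \<open>t\<close>-coordinate, the only one that the objective and complementarity involve.\<close>

definition feasible_t :: "real^'n^'m \<Rightarrow> real^'n^'l \<Rightarrow> real^'m \<Rightarrow> real^'l \<Rightarrow> real \<Rightarrow> (real^'n) set" where
  "feasible_t A B y b \<epsilon> = {t. \<exists>x. norm (y - A *v x) \<le> \<epsilon> \<and> B *v x \<le> b \<and> \<bar>x\<bar> \<le> t}"

lemma convex_feasible_t: "convex (feasible_t A B y b \<epsilon>)"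
proof (rule convexI)
  fix t t' and u v :: real
  assume "t \<in> feasible_t A B y b \<epsilon>" "t' \<in> feasible_t A B y b \<epsilon>"
    and uv: "0 \<le> u" "0 \<le> v" "u + v = 1"
  then obtain x x' where
    x: "norm (y - A *v x) \<le> \<epsilon>" "B *v x \<le> b" "\<bar>x\<bar> \<le> t" and
    x': "norm (y - A *v x') \<le> \<epsilon>" "B *v x' \<le> b" "\<bar>x'\<bar> \<le> t'"
    by (auto simp: feasible_t_def)
  have "y - A *v (u *\<^sub>R x + v *\<^sub>R x') = (u + v) *\<^sub>R y - A *v (u *\<^sub>R x + v *\<^sub>R x')"
    using uv by simp
  also have "\<dots> = u *\<^sub>R (y - A *v x) + v *\<^sub>R (y - A *v x')"
    by (simp add: matrix_vector_right_distrib matrix_vector_mult_scaleR algebra_simps)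
  finally have eq: "y - A *v (u *\<^sub>R x + v *\<^sub>R x') = u *\<^sub>R (y - A *v x) + v *\<^sub>R (y - A *v x')" .
  have "y - A *v (u *\<^sub>R x + v *\<^sub>R x') \<in> cball 0 \<epsilon>"
    unfolding eq by (rule convexD[OF convex_cball]) (use x x' uv in auto)
  then have "norm (y - A *v (u *\<^sub>R x + v *\<^sub>R x')) \<le> \<epsilon>" by simp
  then show "u *\<^sub>R t + v *\<^sub>R t' \<in> feasible_t A B y b \<epsilon>"
    using matrix_convex_combination_le[OF x(2) x'(2) uv] abs_convex_combination_le[OF x(3) x'(3) uv(1,2)]
    by (auto simp: feasible_t_def)
qed

text \<open>Moving from \<open>x0\<close> towards \<open>x\<close> by a fraction
  \<open>\<delta>\<close> changes the residual by at most \<open>\<delta>\<close> times the norm of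
  \<open>A *v (x - x0)\<close>, which the slack at \<open>x0\<close> absorbs when
  \<open>\<delta>\<close> is small.\<close>

lemma slack_mixing:
  assumes slack: "norm (y - A *v x0) < \<epsilon>" and x0: "B *v x0 \<le> b" "\<bar>x0\<bar> \<le> t0"
    and x: "B *v x \<le> b" "\<bar>x\<bar> \<le> t"
  obtains \<delta> where "0 < \<delta>" "\<delta> \<le> 1" "(1 - \<delta>) *\<^sub>R t0 + \<delta> *\<^sub>R t \<in> feasible_t A B y b \<epsilon>"
proof -
  define g where "g = \<epsilon> - norm (y - A *v x0)"
  define N where "N = norm (A *v (x - x0))"
  \<comment> \<open>This choice gives \<open>\<delta> * N \<le> g\<close> and
    \<open>\<delta> \<le> 1\<close> together, and it also covers \<open>N = 0\<close>.\<close>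
  define \<delta> where "\<delta> = g / (g + N)"
  have gN: "0 < g" "0 \<le> N" using slack by (auto simp: g_def N_def)
  then have \<delta>: "0 < \<delta>" "\<delta> \<le> 1" by (auto simp: \<delta>_def)
  have "\<delta> * N \<le> g"
    using gN by (simp add: \<delta>_def field_simps)
  have "y - A *v ((1 - \<delta>) *\<^sub>R x0 + \<delta> *\<^sub>R x) = (y - A *v x0) - \<delta> *\<^sub>R (A *v (x - x0))"
    by (simp add: matrix_vector_right_distrib matrix_vector_mult_diff_distrib
        matrix_vector_mult_scaleR algebra_simps)
  moreover have "norm ((y - A *v x0) - \<delta> *\<^sub>R (A *v (x - x0))) \<le> norm (y - A *v x0) + \<delta> * N"
    using norm_triangle_ineq4[of "y - A *v x0" "\<delta> *\<^sub>R (A *v (x - x0))"] \<delta> by (simp add: N_def)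
  moreover have "norm (y - A *v x0) + \<delta> * N \<le> \<epsilon>" using \<open>\<delta> * N \<le> g\<close> by (simp add: g_def)
  ultimately have "norm (y - A *v ((1 - \<delta>) *\<^sub>R x0 + \<delta> *\<^sub>R x)) \<le> \<epsilon>" by (metis order_trans)
  then have "(1 - \<delta>) *\<^sub>R t0 + \<delta> *\<^sub>R t \<in> feasible_t A B y b \<epsilon>"
    using matrix_convex_combination_le[OF x0(1) x(1), of "1 - \<delta>" \<delta>]
      abs_convex_combination_le[OF x0(2) x(2), of "1 - \<delta>" \<delta>] \<delta>
    by (auto simp: feasible_t_def)
  with \<delta> show ?thesis by (rule that)
qed

text \<open>Pair the dual equation with \<open>x\<close> and discard the nonnegative products of
  multipliers with slacks; Cauchy-Schwarz handles \<open>\<mu>3\<close>. The term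
  \<open>t \<bullet> \<mu>6\<close> is kept so that one inequality yields both dual optimality and
  complementarity.\<close>

lemma weak_duality_gap:
  assumes "(x, t, \<gamma>) \<in> feasible_Pw' A B y b \<epsilon>" and "(\<mu>1, \<mu>2, \<mu>3, \<mu>4, \<mu>5, \<mu>6) \<in> feasible_Dw A B w"
  shows "objective_Dw y b \<epsilon> (\<mu>1, \<mu>2, \<mu>3, \<mu>4, \<mu>5, \<mu>6) + t \<bullet> \<mu>6 \<le> w \<bullet> t"
proof -
  have P: "norm \<gamma> \<le> \<epsilon>" "B *v x \<le> b" "\<gamma> = y - A *v x" "\<bar>x\<bar> \<le> t"
    using assms(1) by (auto simp: feasible_Pw'_def)
  have D: "transpose B *v \<mu>2 - transpose A *v \<mu>3 + \<mu>4 - \<mu>5 = 0" "w = \<mu>4 + \<mu>5 + \<mu>6" "norm \<mu>3 \<le> \<mu>1"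
    "0 \<le> \<mu>2" "0 \<le> \<mu>4" "0 \<le> \<mu>5"
    using assms(2) by (auto simp: feasible_Dw_def)
  have "(transpose B *v \<mu>2 - transpose A *v \<mu>3 + \<mu>4 - \<mu>5) \<bullet> x = 0"
    unfolding D(1) by simp
  then have eq: "\<mu>2 \<bullet> (B *v x) - \<mu>3 \<bullet> (A *v x) + \<mu>4 \<bullet> x - \<mu>5 \<bullet> x = 0"
    by (simp add: inner_add_left inner_diff_left inner_transpose del: transpose_matrix_vector)
  have "0 \<le> t + x" "0 \<le> t - x"
    using order_trans[OF abs_ge_minus_self P(4)] order_trans[OF abs_ge_self P(4)]
      diff_ge_0_iff_ge[of t "- x"] by simp_all
  then have "0 \<le> \<mu>5 \<bullet> (t + x)" "0 \<le> \<mu>4 \<bullet> (t - x)"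
    using D by (auto intro: inner_nonneg_nonneg)
  moreover have "0 \<le> \<mu>2 \<bullet> (b - B *v x)"
    using P(2) D by (auto intro: inner_nonneg_nonneg)
  moreover have "\<mu>3 \<bullet> \<gamma> \<le> norm \<mu>3 * norm \<gamma>"
    by (rule norm_cauchy_schwarz)
  moreover have "norm \<mu>3 * norm \<gamma> \<le> \<mu>1 * \<epsilon>"
    using P(1) D(3) norm_ge_zero[of \<mu>3] norm_ge_zero[of \<gamma>] by (intro mult_mono) linarith+
  ultimately show ?thesis
    using eq by (simp add: objective_Dw_def D(2) P(3) inner_add_left inner_add_right inner_diff_right
        inner_commute[of t])
qed

section \<open>Construction of the strictly complementary pair\<close>

theorem theorem3:
  fixes A :: "real^'n^'m" and B :: "real^'n^'l"
    and y :: "real^'m" and b :: "real^'l" and \<epsilon> :: real and w :: "real^'n"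
  assumes "CARD('m) < CARD('n)" and "CARD('l) \<le> CARD('n)" and "0 \<le> \<epsilon>"
    and G1: "\<exists>xh. optimal_Pw A B y b \<epsilon> w xh \<and> xh \<in> rel_interior (feasible_T A B y b \<epsilon>) \<and>
                   norm (y - A *v xh) < \<epsilon> \<and> B *v xh \<le> b"
    and G2: "0 < value_Pw A B y b \<epsilon> w" "value_Pw A B y b \<epsilon> w < \<infinity>"
    and G3: "\<forall>j. 0 < w $ j"
  shows "\<exists>x t \<gamma> \<mu>1 \<mu>2 \<mu>3 \<mu>4 \<mu>5 \<mu>6.
           optimal_Pw' A B y b \<epsilon> w (x, t, \<gamma>) \<and>
           optimal_Dw A B y b \<epsilon> w (\<mu>1, \<mu>2, \<mu>3, \<mu>4, \<mu>5, \<mu>6) \<and>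
           strictly_complementary t \<mu>6"
proof -
  let ?F = "feasible_t A B y b \<epsilon>"
  obtain x0 where x0: "optimal_Pw A B y b \<epsilon> w x0" "norm (y - A *v x0) < \<epsilon>" "B *v x0 \<le> b"
    using G1 by blast
  have w: "0 \<le> w" using G3 by (simp add: less_eq_vec_def less_imp_le)
  define Z where "Z = w \<bullet> \<bar>x0\<bar>"
  have F_nonneg: "0 \<le> t" if "t \<in> ?F" for t
    using that by (auto simp: feasible_t_def intro: order_trans[OF abs_ge_zero])
  have Z_le: "Z \<le> w \<bullet> t" if t: "t \<in> ?F" for t
  proof -
    obtain x where x: "norm (y - A *v x) \<le> \<epsilon>" "B *v x \<le> b" "\<bar>x\<bar> \<le> t"
      using t by (auto simp: feasible_t_def)
    have "Z \<le> w \<bullet> \<bar>x\<bar>"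
      using x0(1) x by (auto simp: optimal_Pw_def is_arg_min_linorder feasible_T_def Z_def)
    also have "\<dots> \<le> w \<bullet> t"
      using inner_nonneg_nonneg[OF w, of "t - \<bar>x\<bar>"] x(3) by (simp add: inner_diff_right)
    finally show ?thesis .
  qed
  \<comment> \<open>By \<open>Z_le\<close> these are exactly the optimal \<open>t\<close>; the
    inequality presents them as a convex set cut by a halfspace.\<close>
  define S where "S = ?F \<inter> {t. w \<bullet> t \<le> Z}"
  have "convex S"
    unfolding S_def by (intro convex_Int convex_feasible_t convex_halfspace_le)
  moreover have "\<bar>x0\<bar> \<in> S"
    using x0 by (auto simp: S_def feasible_t_def Z_def intro!: exI[of _ x0])
  ultimately obtain t where t: "t \<in> S" "\<And>j s. s \<in> S \<Longrightarrow> t $ j = 0 \<Longrightarrow> s $ j = 0"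
    using F_nonneg by (elim convex_nonneg_maximal_support) (auto simp: S_def)
  have wt: "w \<bullet> t = Z" using t(1) Z_le[of t] by (auto simp: S_def)
  have t_nonneg: "0 \<le> t" using t(1) F_nonneg by (simp add: S_def)
  define p :: "real^'n" where "p = (\<chi> j. if t $ j = 0 then 1 else 0)"
  have p: "0 \<le> p" by (simp add: p_def less_eq_vec_def)
  have p_inner: "p \<bullet> s = 0" if "s \<in> S" for s
    using t(2)[OF that] by (auto simp: p_def inner_vec_def intro!: sum.neutral)

  have alt: "s * Z \<le> w \<bullet> t' - p \<bullet> t'"
    if s: "0 \<le> s" and x: "B *v x \<le> s *\<^sub>R b" "\<bar>x\<bar> \<le> t'" and le: "w \<bullet> t' \<le> s * Z" for s x t'
  proof (cases "s = 0")
    \<comment> \<open>In the recession case \<open>w \<bullet> t' \<le> 0\<close>, and the strict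
      positivity of the weights leaves only \<open>t' = 0\<close>.\<close>
    case True
    have t': "0 \<le> t'" using x(2) by (rule order_trans[OF abs_ge_zero])
    then have "w $ i * t' $ i = 0" for i
    proof -
      have nn: "0 \<le> w $ i * t' $ i" for i
        using t' w by (simp add: less_eq_vec_def)
      have "w \<bullet> t' = 0" using le True inner_nonneg_nonneg[OF w t'] by simp
      then show ?thesis using nn by (simp add: inner_vec_def sum_nonneg_eq_0_iff)
    qed
    then have "t' = 0"
      by (simp add: vec_eq_iff) (metis G3 less_irrefl)
    then show ?thesis using True by simp
  next
    case False
    with s have s: "0 < s" by simp
    define x1 t1 where "x1 = (1 / s) *\<^sub>R x" and "t1 = (1 / s) *\<^sub>R t'"
    have "B *v x1 \<le> (1 / s) *\<^sub>R (s *\<^sub>R b)"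
      unfolding x1_def matrix_vector_mult_scaleR using x(1) s by (intro scaleR_left_mono) auto
    then have "B *v x1 \<le> b" using s by simp
    moreover have "\<bar>x1\<bar> \<le> t1"
      unfolding x1_def t1_def abs_scaleR using x(2) s by (simp add: scaleR_left_mono)
    ultimately obtain \<delta> where \<delta>: "0 < \<delta>" "\<delta> \<le> 1" "(1 - \<delta>) *\<^sub>R \<bar>x0\<bar> + \<delta> *\<^sub>R t1 \<in> ?F"
      using slack_mixing[OF x0(2,3) order_refl] by blast
    let ?t = "(1 - \<delta>) *\<^sub>R \<bar>x0\<bar> + \<delta> *\<^sub>R t1"
    \<comment> \<open>The mixture is feasible, so its value is at least \<open>Z\<close>; as
      \<open>\<delta> > 0\<close>, the value of \<open>t1\<close> is then at least \<open>Z\<close>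
      too. Hence the mixture is optimal, and \<open>p\<close> vanishes on it as well as on
      \<open>\<bar>x0\<bar>\<close>, which forces \<open>p \<bullet> t1 = 0\<close>.\<close>
    have w_mix: "w \<bullet> ?t = Z + \<delta> * (w \<bullet> t1 - Z)"
      by (simp add: inner_add_right Z_def algebra_simps)
    have "w \<bullet> t1 \<le> Z"
      using le s by (simp add: t1_def field_simps)
    moreover have "0 \<le> w \<bullet> t1 - Z"
      using Z_le[OF \<delta>(3)] \<delta>(1) unfolding w_mix by (simp add: zero_le_mult_iff)
    ultimately have w1: "w \<bullet> t1 = Z" by simp
    then have "?t \<in> S" using \<delta>(3) w_mix by (simp add: S_def)
    from p_inner[OF this] have "\<delta> * (p \<bullet> t1) = 0"
      using p_inner[OF \<open>\<bar>x0\<bar> \<in> S\<close>] by (simp add: inner_add_right)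
    then have "p \<bullet> t1 = 0" using \<delta> by simp
    then have "p \<bullet> t' = 0" "w \<bullet> t' = s * Z"
      using w1 s by (auto simp: t1_def field_simps)
    then show ?thesis by simp
  qed
  obtain \<theta> \<mu>2 \<mu>4 \<mu>5 \<mu>6 where \<mu>: "0 \<le> \<theta>" "0 \<le> \<mu>2" "0 \<le> \<mu>4" "0 \<le> \<mu>5" "0 \<le> \<mu>6"
    "transpose B *v \<mu>2 + \<mu>4 - \<mu>5 = 0" "(1 + \<theta>) *\<^sub>R w = \<mu>4 + \<mu>5 + \<mu>6 + p" "(1 + \<theta>) * Z \<le> - (\<mu>2 \<bullet> b)"
    using alt by (rule dual_from_alternative)
  define r where "r = 1 / (1 + \<theta>)"
  have r: "0 < r" "r * (1 + \<theta>) = 1" using \<mu>(1) by (auto simp: r_def)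
  \<comment> \<open>The zero entries are the multipliers of the inactive norm constraint and of the
    residual equation. Adding \<open>p\<close> to \<open>\<mu>6\<close> makes the last component
    positive wherever \<open>t\<close> is zero.\<close>
  define D :: "('l, 'm, 'n) dual_var" where
    "D = (0, r *\<^sub>R \<mu>2, 0, r *\<^sub>R \<mu>4, r *\<^sub>R \<mu>5, r *\<^sub>R (\<mu>6 + p))"
  have "transpose B *v (r *\<^sub>R \<mu>2) + r *\<^sub>R \<mu>4 - r *\<^sub>R \<mu>5 = r *\<^sub>R (transpose B *v \<mu>2 + \<mu>4 - \<mu>5)"
    by (simp add: matrix_vector_mult_scaleR algebra_simps del: transpose_matrix_vector)
  moreover have "w = r *\<^sub>R ((1 + \<theta>) *\<^sub>R w)" using r by simp
  then have "w = r *\<^sub>R \<mu>4 + r *\<^sub>R \<mu>5 + r *\<^sub>R (\<mu>6 + p)"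
    unfolding \<mu>(7) by (simp add: algebra_simps)
  ultimately have D_feas: "D \<in> feasible_Dw A B w"
    using \<mu> p r(1) by (simp add: D_def feasible_Dw_def scaleR_nonneg_nonneg del: transpose_matrix_vector)
  have "r * ((1 + \<theta>) * Z) \<le> r * (- (\<mu>2 \<bullet> b))"
    using \<mu>(8) r(1) by (intro mult_left_mono) auto
  then have D_val: "Z \<le> objective_Dw y b \<epsilon> D"
    using r(2) by (simp add: D_def objective_Dw_def flip: mult.assoc)
  obtain x where x: "norm (y - A *v x) \<le> \<epsilon>" "B *v x \<le> b" "\<bar>x\<bar> \<le> t"
    using t(1) by (auto simp: S_def feasible_t_def)
  have P_feas: "(x, t, y - A *v x) \<in> feasible_Pw' A B y b \<epsilon>"
    using x t_nonneg by (simp add: feasible_Pw'_def)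
  \<comment> \<open>The value of \<open>D\<close> is at least \<open>Z = w \<bullet> t\<close>, so
    the duality gap leaves no room for a positive product.\<close>
  have compl: "t \<bullet> (r *\<^sub>R (\<mu>6 + p)) = 0"
  proof (rule antisym)
    show "t \<bullet> (r *\<^sub>R (\<mu>6 + p)) \<le> 0"
      using weak_duality_gap[OF P_feas D_feas[unfolded D_def]] D_val wt by (simp add: D_def)
    show "0 \<le> t \<bullet> (r *\<^sub>R (\<mu>6 + p))"
      using t_nonneg \<mu>(5) p r(1) by (intro inner_nonneg_nonneg scaleR_nonneg_nonneg) auto
  qed
  have "optimal_Pw' A B y b \<epsilon> w (x, t, y - A *v x)"
    using P_feas Z_le wt by (auto simp: optimal_Pw'_def is_arg_min_linorder feasible_Pw'_def feasible_t_def)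
  moreover have "optimal_Dw A B y b \<epsilon> w D"
    unfolding optimal_Dw_def is_arg_max_linorder
  proof (intro conjI allI impI D_feas)
    fix D' assume D': "D' \<in> feasible_Dw A B w"
    obtain \<nu>1 \<nu>2 \<nu>3 \<nu>4 \<nu>5 \<nu>6 where D'_eq: "D' = (\<nu>1, \<nu>2, \<nu>3, \<nu>4, \<nu>5, \<nu>6)" by (rule prod_cases6)
    have "0 \<le> t \<bullet> \<nu>6"
      using D' t_nonneg by (auto simp: D'_eq feasible_Dw_def intro: inner_nonneg_nonneg)
    then show "objective_Dw y b \<epsilon> D' \<le> objective_Dw y b \<epsilon> D"
      using weak_duality_gap[OF P_feas D'[unfolded D'_eq]] D_val wt by (simp add: D'_eq)
  qed
  moreover have "strictly_complementary t (r *\<^sub>R (\<mu>6 + p))"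
    unfolding strictly_complementary_def
  proof (intro conjI allI compl t_nonneg)
    show nn: "0 \<le> r *\<^sub>R (\<mu>6 + p)"
      using \<mu>(5) p r(1) by (intro scaleR_nonneg_nonneg) auto
    fix i
    show "0 < (t + r *\<^sub>R (\<mu>6 + p)) $ i"
    proof (cases "t $ i = 0")
      case True
      moreover have "0 \<le> \<mu>6 $ i" using \<mu>(5) by (simp add: less_eq_vec_def)
      ultimately show ?thesis using r(1) by (simp add: p_def)
    next
      case False
      moreover have "0 \<le> t $ i" "0 \<le> (r *\<^sub>R (\<mu>6 + p)) $ i"
        using t_nonneg nn unfolding less_eq_vec_def by simp_all
      ultimately show ?thesis unfolding vector_add_component by linarith
    qed
  qed
  ultimately show ?thesis
    unfolding D_def by (intro exI conjI)
qed

end
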